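(* Let $\Sigma$ be an alphabet of size $\sigma \ge 2$, let $T$ be an ordered rooted tree with $n_T$ nodes, each labelled with a symbol of $\Sigma$, let $\mathcal{T}$ be the (labelled) top tree of $T$ and let $\mathcal{TD}$ be its top DAG, of total size $n_{TD}$ (number of nodes plus number of edges). Then $$n_{TD} = O\!\left(\frac{n_T}{\log_\sigma n_T}\cdot \log\log_\sigma n_T\right).$$
   Context: Top tree construction (Bille, Gørtz, Landau, Weimann). Let $T$ be an ordered rooted labelled tree. We maintain an auxiliary ordered rooted tree $T_j$ (initially $T_0=T$) in which every edge $e$ is associated with a node $C(e)$ (a "cluster") of a binary forest under construction. Initially, for every edge $(u,v)$ of $T$ with $v$ a child of $u$, a leaf cluster is created and labelled with the label of the child endpoint $v$ (only this label is stored). Iteration $j$ builds $T_{j+1}$ from $T_j$ by the following two steps; every edge of $T_j$ takes part in at most one merge per iteration. Step 1 (horizontal merges): for each node $v$ of $T_j$ with $k\ge 2$ children $v_1,\dots,v_k$ (in order), for $i=1,\dots,\lfloor k/2\rfloor$ merge the edges $(v,v_{2i-1})$ and $(v,v_{2i})$ if $v_{2i-1}$ or $v_{2i}$ is a leaf of $T_j$; if $k$ is odd, $v_k$ is a leaf and both $v_{k-2},v_{k-1}$ are non-leaves, also merge $(v,v_{k-1})$ and $(v,v_k)$. Merging $(v,x)$ and $(v,y)$, with $x$ the earlier sibling, creates a new cluster with left child $C((v,x))$ and right child $C((v,y))$, labelled with merge type (c) if $x$ is a non-leaf, (d) if $y$ is a non-leaf, (e) if both are leaves; in the tree the two edges are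 replaced (at the position of the first) by one edge from $v$ to the non-leaf among $x,y$ (keeping its subtree), or to a leaf if both are leaves. Step 2 (vertical merges): for each maximal path $v_1,\dots,v_p$ of nodes of $T_j$ such that $v_{i+1}$ is the parent of $v_i$ and $v_2,\dots,v_{p-1}$ each have exactly one child, write $e_i=(v_i,v_{i+1})$. If $p$ is even, merge the pairs $\{e_1,e_2\},\{e_3,e_4\},\dots,\{e_{p-3},e_{p-2}\}$; if $p$ is odd, merge $\{e_1,e_2\},\dots,\{e_{p-4},e_{p-3}\}$ and, if $e_{p-1}$ was not merged in Step 1, also $\{e_{p-2},e_{p-1}\}$. Merging a lower edge $(a,b)$ with the upper edge $(b,c)$ (where $b$ has the single child $a$) creates a cluster with left child $C((b,c))$ and right child $C((a,b))$, labelled with merge type (a) if $a$ is a non-leaf of $T_j$ and (b) if $a$ is a leaf; in the tree, $b$ is removed and the two edges are replaced by the single edge $(a,c)$ at the position of $(b,c)$. Iterations are repeated until a single edge remains. Finally a dummy leaf cluster labelled with the label of the root of $T$ (representing a dummy edge entering the root) is merged, as left child and with merge type (a), with the cluster of the last remaining edge; the result is the root of the top tree $\mathcal{T}$. Thus $\mathcal{T}$ is an ordered full binary tree whose leaves are labelled with symbols of $\Sigma$ and whose inner nodes are labelled with one of five merge types (a)–(e). The top DAG $\mathcal{TD}$ is the minimal DAG of $\mathcal{T}$, obtained by representing every set of identical (equal as ordered labelled trees) subtrees of $\mathcal{T}$ by a single shared node; its size $n_{TD}$ is its number of nodes plus edges. *)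

theory Defs
  imports Complex_Main "HOL-Library.While_Combinator"
begin

datatype 'a otree = ONode (label: 'a) (children: "'a otree list")

primrec num_nodes :: "'a otree \<Rightarrow> nat" where
  "num_nodes (ONode a ts) = Suc (sum_list (map num_nodes ts))"

datatype merge_type = MA | MB | MC | MD | ME

datatype 'a cluster = CLeaf 'a | CMerge merge_type "'a cluster" "'a cluster"

text \<open>The auxiliary trees \<open>T\<^sub>j\<close>. A node is the ordered list of its outgoing edges, each edge
  carrying an annotation (its cluster) and leading to a child. The node labels of \<open>T\<close> enter only
  through the initial leaf clusters.\<close>

datatype 'e aux_tree = Aux (edges: "('e \<times> 'e aux_tree) list")

abbreviation is_leaf :: "'e aux_tree \<Rightarrow> bool" where
  "is_leaf t \<equiv> edges t = []"

fun initial :: "'a otree \<Rightarrow> 'a cluster aux_tree" where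
  "initial (ONode a ts) =
     Aux (map (\<lambda>t. (CLeaf (label t), initial t)) ts)"

text \<open>Step 1. In its result every edge carries, besides its cluster, a flag telling whether it was
  created by a horizontal merge.\<close>

fun hmerge_edges ::
  "'a cluster \<times> 'e aux_tree \<Rightarrow> 'a cluster \<times> 'e aux_tree \<Rightarrow> ('a cluster \<times> bool) \<times> 'e aux_tree" where
  "hmerge_edges (c, x) (d, y) =
     (if \<not> is_leaf x then ((CMerge MC c d, True), x)
      else if \<not> is_leaf y then ((CMerge MD c d, True), y)
      else ((CMerge ME c d, True), x))"

fun keep_edge :: "'a cluster \<times> 'e aux_tree \<Rightarrow> ('a cluster \<times> bool) \<times> 'e aux_tree" where
  "keep_edge (c, x) = ((c, False), x)"

definition hpair ::
  "'a cluster \<times> 'e aux_tree \<Rightarrow> 'a cluster \<times> 'e aux_tree \<Rightarrow> (('a cluster \<times> bool) \<times> 'e aux_tree) list" where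
  "hpair e f =
     (if is_leaf (snd e) \<or> is_leaf (snd f) then [hmerge_edges e f] else [keep_edge e, keep_edge f])"

text \<open>The edges are consumed from the left in pairs, so the three-element case below is reached
  exactly when the number \<open>k \<ge> 3\<close> of children is odd, with the last three edges.\<close>

fun hmerge :: "('a cluster \<times> 'e aux_tree) list \<Rightarrow> (('a cluster \<times> bool) \<times> 'e aux_tree) list" where
  "hmerge [] = []"
| "hmerge [e] = [keep_edge e]"
| "hmerge [e, f, g] =
     (if \<not> is_leaf (snd e) \<and> \<not> is_leaf (snd f) \<and> is_leaf (snd g)
      then [keep_edge e, hmerge_edges f g]
      else hpair e f @ [keep_edge g])"
| "hmerge (e # f # es) = hpair e f @ hmerge es"

text \<open>Horizontal merges never turn a leaf into a non-leaf or conversely, so testing the already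
  processed children for being leaves is the same as testing the children in \<open>T\<^sub>j\<close>.\<close>

primrec horizontal :: "'a cluster aux_tree \<Rightarrow> ('a cluster \<times> bool) aux_tree" where
  "horizontal (Aux es) = Aux (hmerge (map (map_prod id horizontal) es))"

text \<open>Step 2. A node has exactly one child in \<open>T\<^sub>j\<close> iff after Step 1 it has exactly one outgoing edge
  and that edge is not flagged as merged. For a node \<open>v\<close>, \<open>path_below\<close> follows these unary nodes
  downwards from \<open>v\<close> as long as possible, and returns the clusters of the edges passed (top to
  bottom) and the final node, which is a leaf or has at least two children in \<open>T\<^sub>j\<close>.\<close>

fun path_below :: "('c \<times> bool) aux_tree \<Rightarrow> 'c list \<times> ('c \<times> bool) aux_tree" where
  "path_below (Aux [((c, False), t)]) = (let (cs, b) = path_below t in (c # cs, b))"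
| "path_below t = ([], t)"

lemma size_path_below: "path_below t = (cs, b) \<Longrightarrow> size b \<le> size t"
  by (induction t arbitrary: cs b rule: path_below.induct)
     (force split: prod.splits)+

text \<open>Merges consecutive pairs of edges of a path; the clusters are listed from top to bottom, and
  \<open>lf\<close> tells whether the bottom node of the path is a leaf.\<close>

fun vpairs :: "bool \<Rightarrow> 'a cluster list \<Rightarrow> 'a cluster list" where
  "vpairs lf (u # l # cs) =
     CMerge (if cs = [] \<and> lf then MB else MA) u l # vpairs lf cs"
| "vpairs lf cs = cs"

text \<open>For a maximal path \<open>v\<^sub>1, \<dots>, v\<^sub>p\<close>: \<open>c\<close> and \<open>m\<close> are the cluster and the flag of its
  top edge \<open>e\<^bsub>p-1\<^esub>\<close>, and \<open>cs\<close> lists the clusters of \<open>e\<^bsub>p-2\<^esub>, \<dots>, e\<^sub>1\<close>, so that \<open>p = length cs + 2\<close>.\<close>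

fun vmerge :: "bool \<Rightarrow> 'a cluster \<times> bool \<Rightarrow> 'a cluster list \<Rightarrow> 'a cluster list" where
  "vmerge lf (c, m) cs =
     (if even (length cs) then c # vpairs lf cs
      else if m then c # hd cs # vpairs lf (tl cs)
      else vpairs lf (c # cs))"

fun build_path :: "'c list \<Rightarrow> 'c aux_tree \<Rightarrow> 'c aux_tree" where
  "build_path [] b = b"
| "build_path (c # cs) b = Aux [(c, build_path cs b)]"

text \<open>\<open>vertical\<close> is only ever applied to the upper end of maximal paths (the root or a node that is
  not unary in \<open>T\<^sub>j\<close>) and to leaves.\<close>

function vertical :: "('a cluster \<times> bool) aux_tree \<Rightarrow> 'a cluster aux_tree" where
  "vertical (Aux es) =
     Aux (map (\<lambda>(e, t).
       (case path_below t of (cs, b) \<Rightarrow>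
         (case vmerge (is_leaf b) e cs of d # ds \<Rightarrow> (d, build_path ds (vertical b))))) es)"
  by pat_completeness auto
termination
  by (relation "measure size")
     (auto simp: less_Suc_eq_le intro!: size_list_estimation' le_SucI
           dest!: size_path_below[OF sym])

definition iteration :: "'a cluster aux_tree \<Rightarrow> 'a cluster aux_tree" where
  "iteration t = vertical (horizontal t)"

definition single_edge :: "'e aux_tree \<Rightarrow> bool" where
  "single_edge t \<longleftrightarrow> (\<exists>c. t = Aux [(c, Aux [])])"

text \<open>Meaningful for trees with at least one edge.\<close>

definition top_tree :: "'a otree \<Rightarrow> 'a cluster" where
  "top_tree T =
     CMerge MA (CLeaf (label T))
       (fst (hd (edges (while (\<lambda>t. \<not> single_edge t) iteration (initial T)))))"

primrec subtrees :: "'a cluster \<Rightarrow> 'a cluster set" where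
  "subtrees (CLeaf a) = {CLeaf a}"
| "subtrees (CMerge m l r) = insert (CMerge m l r) (subtrees l \<union> subtrees r)"

text \<open>The minimal DAG: its nodes are the distinct subtrees. An edge also records whether it leads to
  the left (\<open>False\<close>) or right (\<open>True\<close>) child, so an inner node with two identical children still has
  two outgoing edges.\<close>

definition dag_nodes :: "'a cluster \<Rightarrow> 'a cluster set" where
  "dag_nodes t = subtrees t"

definition dag_edges :: "'a cluster \<Rightarrow> ('a cluster \<times> bool \<times> 'a cluster) set" where
  "dag_edges t =
     {(CMerge m l r, False, l) | m l r. CMerge m l r \<in> subtrees t} \<union>
     {(CMerge m l r, True, r) | m l r. CMerge m l r \<in> subtrees t}"

definition top_dag_size :: "'a otree \<Rightarrow> nat" where
  "top_dag_size T = card (dag_nodes (top_tree T)) + card (dag_edges (top_tree T))"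

end

theory Submission
  imports Defs
begin

text \<open>
  An iteration shrinks the number of edges by a factor of at least \<open>8/9\<close>: every leaf lies on or next
  to a merge, and a tree with few leaves consists mostly of long unary paths, half of whose edges
  disappear. So \<open>T\<^sub>j\<close> has at most \<open>(8/9)\<^sup>j n\<close> edges, while the leaf counts of the clusters on its
  edges always add up to \<open>n - 1\<close>. Put \<open>L = log\<^sub>\<sigma> n\<close> and call a cluster large if it has more than
  \<open>L/12\<close> leaves. Each iteration contributes \<open>O(n/L)\<close> large clusters, and the iterations after the first
  \<open>O(log L)\<close> contribute only \<open>O(n/L)\<close> clusters altogether, which gives \<open>O(n/L log L)\<close> large
  clusters. Distinct small clusters have distinct preorder words of length less than \<open>L/6\<close> over
  \<open>\<sigma> + 5 \<le> \<sigma>\<^sup>3\<close> symbols, so there are at most \<open>\<surd>n\<close> of them.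
\<close>

section \<open>Sums over the edges of an auxiliary tree\<close>

primrec wsum :: "('e \<Rightarrow> nat) \<Rightarrow> 'e aux_tree \<Rightarrow> nat" where
  "wsum f (Aux es) = sum_list (map (\<lambda>(e, w). f e + w) (map (map_prod id (wsum f)) es))"

abbreviation edge_wsum :: "('e \<Rightarrow> nat) \<Rightarrow> 'e \<times> 'e aux_tree \<Rightarrow> nat" where
  "edge_wsum f p \<equiv> f (fst p) + wsum f (snd p)"

abbreviation num_edges :: "'e aux_tree \<Rightarrow> nat" where
  "num_edges \<equiv> wsum (\<lambda>_. 1)"

lemma wsum_Aux [simp]: "wsum f (Aux es) = sum_list (map (edge_wsum f) es)"
  by (simp add: case_prod_unfold comp_def)

declare wsum.simps [simp del]

lemma wsum_leaf: "is_leaf t \<Longrightarrow> wsum f t = 0"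
  by (cases t) simp

lemma wsum_mono: "(\<And>e. f e \<le> g e) \<Longrightarrow> wsum f t \<le> wsum g t"
proof (induction t)
  case (Aux es)
  have "edge_wsum f p \<le> edge_wsum g p" if "p \<in> set es" for p
    using Aux.IH[OF that, of "snd p"] Aux.prems by (cases p) (auto intro: add_mono)
  then show ?case by (simp add: sum_list_mono)
qed

lemma set_aux_tree_Aux:
  "set_aux_tree (Aux es) = (\<Union>p\<in>set es. insert (fst p) (set_aux_tree (snd p)))"
  by auto

lemma finite_set_aux_tree [simp]: "finite (set_aux_tree t)"
proof (induction t)
  case (Aux es)
  have "finite (set_aux_tree (snd p))" if "p \<in> set es" for p
    using Aux.IH[OF that, of "snd p"] by (cases p) auto
  then show ?case by (simp add: set_aux_tree_Aux del: aux_tree.set)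
qed

lemma sum_set_aux_tree_le_wsum: "(\<Sum>e\<in>set_aux_tree t. f e) \<le> wsum f t"
proof (induction t)
  case (Aux es)
  have *: "(\<Sum>e\<in>insert (fst p) (set_aux_tree (snd p)). f e) \<le> edge_wsum f p" if "p \<in> set es" for p
    using Aux.IH[OF that, of "snd p"] by (cases p) (auto simp: sum.insert_if)
  have "(\<Sum>e\<in>(\<Union>p\<in>set ps. insert (fst p) (set_aux_tree (snd p))). f e) \<le> sum_list (map (edge_wsum f) ps)"
    if "set ps \<subseteq> set es" for ps
    using that
  proof (induction ps)
    case (Cons p ps)
    let ?A = "insert (fst p) (set_aux_tree (snd p))"
    let ?B = "\<Union>p\<in>set ps. insert (fst p) (set_aux_tree (snd p))"
    have "sum f (?A \<union> ?B) \<le> sum f ?A + sum f ?B"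
      using sum.union_inter[of ?A ?B f] by simp
    then show ?case using Cons *[of p] by simp
  qed simp
  from this[OF subset_refl] show ?case by (simp add: set_aux_tree_Aux del: aux_tree.set)
qed

primrec csize :: "'a cluster \<Rightarrow> nat" where
  "csize (CLeaf a) = 1"
| "csize (CMerge m l r) = csize l + csize r"

lemma csize_pos: "csize c \<ge> 1"
  by (induction c) auto

section \<open>Horizontal merges\<close>

lemma keep_edge_simps [simp]:
  "snd (keep_edge e) = snd e" "fst (keep_edge e) = (fst e, False)"
  by (cases e; simp)+

lemma wsum_hmerge_edges:
  assumes "\<And>m c d. g (CMerge m c d, True) = f c + f d"
    and "is_leaf (snd e) \<or> is_leaf (snd h)"
  shows "edge_wsum g (hmerge_edges e h) = f (fst e) + f (fst h) + wsum g (snd e) + wsum g (snd h)"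
  using assms by (cases e; cases h) (auto simp: wsum_leaf)

lemma wsum_hmerge:
  assumes "\<And>c. g (c, False) = f c" "\<And>m c d. g (CMerge m c d, True) = f c + f d"
  shows "sum_list (map (edge_wsum g) (hmerge es)) = sum_list (map (\<lambda>p. f (fst p) + wsum g (snd p)) es)"
proof -
  have "sum_list (map (edge_wsum g) (hpair e h)) = f (fst e) + f (fst h) + wsum g (snd e) + wsum g (snd h)" for e h
    using wsum_hmerge_edges[of g f, OF assms(2)] by (simp add: hpair_def assms(1))
  then show ?thesis
    using wsum_hmerge_edges[of g f, OF assms(2)]
    by (induction es rule: hmerge.induct) (simp_all add: assms(1))
qed

lemma wsum_horizontal:
  assumes "\<And>c. g (c, False) = f c" "\<And>m c d. g (CMerge m c d, True) = f c + f d"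
  shows "wsum g (horizontal t) = wsum f t"
proof (induction t)
  case (Aux es)
  have "wsum g (horizontal (snd p)) = wsum f (snd p)" if "p \<in> set es" for p
    using Aux.IH[OF that, of "snd p"] by (cases p) auto
  then show ?case
    by (simp add: wsum_hmerge[of g f, OF assms] comp_def cong: map_cong)
qed

lemma hmerge_eq_Nil [simp]: "hmerge es = [] \<longleftrightarrow> es = []"
  by (induction es rule: hmerge.induct) (auto simp: hpair_def)

lemma is_leaf_horizontal [simp]: "is_leaf (horizontal t) \<longleftrightarrow> is_leaf t"
  by (cases t) simp

text \<open>What Step 1 achieves: apart from the child of a unary node, at most one leaf child of a node is left
  unmerged, and only next to a merged edge.\<close>

inductive leaves_charged :: "('c \<times> bool) aux_tree \<Rightarrow> bool" where
  leaves_charged_Aux: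
  "length es = 1 \<or> length (filter (is_leaf \<circ> snd) es) \<le> 2 * length (filter (snd \<circ> fst) es) \<Longrightarrow>
   (\<And>p. p \<in> set es \<Longrightarrow> leaves_charged (snd p)) \<Longrightarrow> leaves_charged (Aux es)"

lemma hmerge_leaves:
  "length es \<noteq> 1 \<Longrightarrow> length (filter (is_leaf \<circ> snd) (hmerge es)) \<le> 2 * length (filter (snd \<circ> fst) (hmerge es))"
  for es :: "('a cluster \<times> 'e aux_tree) list"
proof -
  have f: "snd (fst (hmerge_edges e h))" for e h :: "'a cluster \<times> 'e aux_tree"
    by (cases e; cases h; simp)
  show "length es \<noteq> 1 \<Longrightarrow> ?thesis"
    by (induction es rule: hmerge.induct) (auto simp: hpair_def f)
qed

lemma hmerge_children: "p \<in> set (hmerge es) \<Longrightarrow> snd p \<in> snd ` set es"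
proof -
  have f: "snd (hmerge_edges e h) = snd e \<or> snd (hmerge_edges e h) = snd h"
    for e h :: "'a cluster \<times> 'e aux_tree"
    by (cases e; cases h; simp)
  show "p \<in> set (hmerge es) \<Longrightarrow> snd p \<in> snd ` set es"
    by (induction es rule: hmerge.induct)
       (use f in \<open>fastforce simp: hpair_def split: if_splits\<close>)+
qed

lemma leaves_charged_horizontal: "leaves_charged (horizontal t)"
proof (induction t)
  case (Aux es)
  have *: "leaves_charged (horizontal (snd p))" if "p \<in> set es" for p
    using Aux.IH[OF that, of "snd p"] by (cases p) auto
  let ?es = "map (map_prod id horizontal) es"
  have "leaves_charged (Aux (hmerge ?es))"
  proof (rule leaves_charged_Aux)
    show "length (hmerge ?es) = 1 \<or> length (filter (is_leaf \<circ> snd) (hmerge ?es)) \<le> 2 * length (filter (snd \<circ> fst) (hmerge ?es))"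
    proof (cases "length es = 1")
      case True
      then obtain e where "es = [e]" by (auto simp: length_Suc_conv)
      then show ?thesis by simp
    next
      case False
      then show ?thesis using hmerge_leaves[of ?es] by simp
    qed
  qed (use * in \<open>auto dest!: hmerge_children\<close>)
  then show ?case by simp
qed

section \<open>Vertical merges\<close>

lemma length_vpairs: "length (vpairs lf cs) = (length cs + 1) div 2"
  by (induction lf cs rule: vpairs.induct) auto

lemma length_vmerge:
  "length (vmerge lf (c, m) cs) =
    (if even (length cs) then 1 + length cs div 2
     else if m then 2 + length cs div 2 else 1 + length cs div 2)"
proof (cases "even (length cs)")
  case False
  then obtain k where "length cs = 2 * k + 1" by (elim oddE)
  then show ?thesis by (simp add: length_vpairs)
next
  case True
  then obtain k where "length cs = 2 * k" by (elim evenE)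
  then show ?thesis by (simp add: length_vpairs)
qed

lemma vmerge_not_Nil: "vmerge lf e cs \<noteq> []"
proof -
  have "length (vmerge lf e cs) \<noteq> 0"
    by (cases e) (simp only: length_vmerge, simp)
  then show ?thesis by (simp only: length_0_conv not_False_eq_True)
qed

lemma length_vmerge_bound:
  assumes "m \<or> cs \<noteq> []"
  shows "9 * length (vmerge lf (c, m) cs) + 6 \<le> 8 * (length cs + 1 + of_bool m)"
proof (cases "even (length cs)")
  case False
  then obtain k where "length cs = 2 * k + 1" by (elim oddE)
  then show ?thesis by (simp add: length_vmerge del: vmerge.simps)
next
  case True
  then obtain k where k: "length cs = 2 * k" by (elim evenE)
  then have "m \<or> k \<ge> 1" using assms by (cases cs; cases k) auto
  then show ?thesis using k by (auto simp: length_vmerge simp del: vmerge.simps)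
qed

lemma sum_vpairs:
  assumes "\<And>m u l. f (CMerge m u l) = f u + f l"
  shows "sum_list (map f (vpairs lf cs)) = (sum_list (map f cs) :: nat)"
  by (induction lf cs rule: vpairs.induct) (auto simp: assms)

lemma sum_vmerge:
  assumes "\<And>m u l. f (CMerge m u l) = f u + f l"
  shows "sum_list (map f (vmerge lf e cs)) = (f (fst e) + sum_list (map f cs) :: nat)"
  by (cases e; cases cs) (auto simp: assms sum_vpairs)

lemma path_below_wsum:
  "path_below t = (cs, b) \<Longrightarrow> wsum f t = sum_list (map (\<lambda>c. f (c, False)) cs) + wsum f b"
  by (induction t arbitrary: cs b rule: path_below.induct) (auto split: prod.splits)

lemma path_below_leaves_charged:
  "path_below t = (cs, b) \<Longrightarrow> leaves_charged t \<Longrightarrow> leaves_charged b"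
  by (induction t arbitrary: cs b rule: path_below.induct)
     (auto split: prod.splits elim: leaves_charged.cases)

lemma path_below_bottom: "path_below t = (cs, b) \<Longrightarrow> b \<noteq> Aux [((c, False), u)]"
  by (induction t arbitrary: cs b rule: path_below.induct) (auto split: prod.splits)

lemma path_below_Nil: "path_below t = ([], b) \<Longrightarrow> b = t"
  by (induction t rule: path_below.induct) (auto split: prod.splits)

lemma path_below_set:
  "path_below t = (cs, b) \<Longrightarrow>
    set cs \<subseteq> fst ` set_aux_tree t \<and> set_aux_tree b \<subseteq> set_aux_tree t"
  by (induction t arbitrary: cs b rule: path_below.induct)
     (force simp: set_aux_tree_Aux simp del: aux_tree.set split: prod.splits)+

lemma path_induct:
  fixes P :: "('a cluster \<times> bool) aux_tree \<Rightarrow> bool"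
  assumes "\<And>es. (\<And>e t cs b. (e, t) \<in> set es \<Longrightarrow> path_below t = (cs, b) \<Longrightarrow> P b) \<Longrightarrow> P (Aux es)"
  shows "P t"
proof (induction t rule: vertical.induct)
  case (1 es)
  show ?case
  proof (rule assms)
    fix e t cs b assume p: "(e, t) \<in> set es" "path_below t = (cs, b)"
    obtain d ds where "vmerge (is_leaf b) e cs = d # ds"
      using vmerge_not_Nil by (metis list.exhaust)
    then show "P b" using 1 p by metis
  qed
qed

definition vertical_edge ::
  "('a cluster \<times> bool) \<times> ('a cluster \<times> bool) aux_tree \<Rightarrow> 'a cluster \<times> 'a cluster aux_tree" where
  "vertical_edge = (\<lambda>(e, t). case path_below t of (cs, b) \<Rightarrow>
     (case vmerge (is_leaf b) e cs of d # ds \<Rightarrow> (d, build_path ds (vertical b))))"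

lemma vertical_Aux: "vertical (Aux es) = Aux (map vertical_edge es)"
  by (simp add: vertical_edge_def)

declare vertical.simps [simp del]

lemma wsum_build_path: "wsum f (build_path cs b) = sum_list (map f cs) + wsum f b"
  by (induction cs) auto

lemma wsum_vertical_edge:
  assumes "path_below t = (cs, b)"
  shows "edge_wsum f (vertical_edge (e, t)) =
    sum_list (map f (vmerge (is_leaf b) e cs)) + wsum f (vertical b)"
  using vmerge_not_Nil[of "is_leaf b" e cs]
  by (auto simp: vertical_edge_def assms wsum_build_path split: list.splits simp del: vmerge.simps)

lemma wsum_vertical:
  assumes "\<And>m u l. f (CMerge m u l) = f u + f l"
  shows "wsum f (vertical t) = wsum (f \<circ> fst) t"
proof (induction t rule: path_induct)
  case (1 es)
  have "edge_wsum f (vertical_edge p) = edge_wsum (f \<circ> fst) p" if p: "p \<in> set es" for p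
  proof -
    obtain e t cs b where q: "p = (e, t)" "path_below t = (cs, b)" by (metis surj_pair)
    show ?thesis
      using 1[of e t cs b] p wsum_vertical_edge[OF q(2)] path_below_wsum[OF q(2)]
      by (simp add: q sum_vmerge assms comp_def del: vmerge.simps)
  qed
  then show ?case by (simp add: vertical_Aux comp_def cong: map_cong)
qed

text \<open>An edge that was merged in Step 1 stands for two edges of \<open>T\<^sub>j\<close>.\<close>

abbreviation flag_weight :: "'c \<times> bool \<Rightarrow> nat" where
  "flag_weight e \<equiv> 1 + of_bool (snd e)"

lemma num_edges_vertical_edge:
  assumes IH: "\<And>cs b. path_below t = (cs, b) \<Longrightarrow> \<not> is_leaf b \<Longrightarrow>
    9 * num_edges (vertical b) + 2 \<le> 8 * wsum flag_weight b"
  shows "9 * edge_wsum (\<lambda>_. 1) (vertical_edge (e, t)) + 6 * of_bool (snd e) + of_bool (\<not> snd e \<and> \<not> is_leaf t)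
    \<le> 8 * edge_wsum flag_weight (e, t) + of_bool (is_leaf t)"
proof -
  obtain cs b where q: "path_below t = (cs, b)" by fastforce
  obtain c m where e: "e = (c, m)" by fastforce
  have b: "9 * num_edges (vertical b) + 2 * of_bool (\<not> is_leaf b) \<le> 8 * wsum flag_weight b"
    using IH[OF q] by (cases "is_leaf b"; cases b) (auto simp: vertical_Aux)
  have sl: "sum_list (map (\<lambda>_. 1) xs) = length xs" for xs :: "'z list"
    by (induction xs) auto
  have w: "wsum flag_weight t = length cs + wsum flag_weight b"
    using path_below_wsum[OF q, of flag_weight] by (simp add: sl[unfolded One_nat_def])
  have v: "edge_wsum (\<lambda>_. 1) (vertical_edge (e, t)) = length (vmerge (is_leaf b) e cs) + num_edges (vertical b)"
    using wsum_vertical_edge[OF q, of "\<lambda>_. 1"] by (simp only: sl)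
  show ?thesis
  proof (cases "m \<or> cs \<noteq> []")
    case True
    from length_vmerge_bound[OF this, of "is_leaf b" c] b w show ?thesis
      unfolding v by (cases m) (auto simp: e simp del: vmerge.simps)
  next
    case False
    then have "b = t" using q path_below_Nil by blast
    with False b show ?thesis unfolding v by (auto simp: e)
  qed
qed

lemma num_edges_vertical_sum:
  assumes "\<And>p. p \<in> set es \<Longrightarrow> 
     9 * edge_wsum (\<lambda>_. 1) (vertical_edge p) + 6 * of_bool (snd (fst p)) + of_bool (\<not> snd (fst p) \<and> \<not> is_leaf (snd p))
    \<le> 8 * edge_wsum flag_weight p + of_bool (is_leaf (snd p))"
  shows "9 * num_edges (vertical (Aux es)) + 6 * length (filter (snd \<circ> fst) es)
     + length (filter (\<lambda>p. \<not> snd (fst p) \<and> \<not> is_leaf (snd p)) es)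
    \<le> 8 * wsum flag_weight (Aux es) + length (filter (is_leaf \<circ> snd) es)"
  using assms by (induction es) (fastforce simp: vertical_Aux)+

text \<open>The slack \<open>2\<close> makes the induction work: an unmerged edge that forms a path of its own costs \<open>1\<close>,
  which leaves \<open>1\<close> for each of the at least two children.\<close>

lemma num_edges_vertical_branching:
  assumes "leaves_charged t" "\<not> is_leaf t" "\<And>c u. t \<noteq> Aux [((c, False), u)]"
  shows "9 * num_edges (vertical t) + 2 \<le> 8 * wsum flag_weight t"
  using assms
proof (induction t rule: path_induct)
  case (1 es)
  from 1(2) have ch: "length es = 1 \<or> length (filter (is_leaf \<circ> snd) es) \<le> 2 * length (filter (snd \<circ> fst) es)"
    and ch': "\<And>p. p \<in> set es \<Longrightarrow> leaves_charged (snd p)"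
    by (auto elim: leaves_charged.cases)
  have "9 * edge_wsum (\<lambda>_. 1) (vertical_edge p) + 6 * of_bool (snd (fst p)) + of_bool (\<not> snd (fst p) \<and> \<not> is_leaf (snd p))
    \<le> 8 * edge_wsum flag_weight p + of_bool (is_leaf (snd p))" if "p \<in> set es" for p
  proof -
    obtain e t where p: "p = (e, t)" by fastforce
    then show ?thesis
      using num_edges_vertical_edge[of t e] 1(1)[of e t] that ch'[OF that]
        path_below_bottom path_below_leaves_charged by fastforce
  qed
  from num_edges_vertical_sum[OF this]
  have S: "9 * num_edges (vertical (Aux es)) + 6 * length (filter (snd \<circ> fst) es)
     + length (filter (\<lambda>p. \<not> snd (fst p) \<and> \<not> is_leaf (snd p)) es)
    \<le> 8 * wsum flag_weight (Aux es) + length (filter (is_leaf \<circ> snd) es)" .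
  show ?case
  proof (cases "length es = 1")
    case True
    then obtain e t where es: "es = [(e, t)]" by (auto simp: length_Suc_conv)
    with 1(4) have "snd e" by (cases e) auto
    with S es show ?thesis by (auto simp del: wsum_Aux split: if_splits)
  next
    case False
    with 1(3) have 2: "length es \<ge> 2" by (cases es; cases "tl es") auto
    show ?thesis
    proof (cases "filter (snd \<circ> fst) es = []")
      case True
      then have l: "filter (is_leaf \<circ> snd) es = []" using False ch by simp
      from True l have "filter (\<lambda>p. \<not> snd (fst p) \<and> \<not> is_leaf (snd p)) es = es"
        by (auto simp: filter_empty_conv)
      with S 2 True l show ?thesis by (simp del: wsum_Aux)
    next
      case f: False
      then have "length (filter (snd \<circ> fst) es) \<ge> 1" by (simp add: Suc_leI del: filter_empty_conv)
      then show ?thesis using S ch False by linarith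
    qed
  qed
qed

lemma num_edges_vertical:
  assumes "leaves_charged t" "\<not> is_leaf t" "\<And>c. t \<noteq> Aux [((c, False), Aux [])]"
  shows "9 * num_edges (vertical t) + 1 \<le> 8 * wsum flag_weight t"
proof (cases "\<exists>c u. t = Aux [((c, False), u)]")
  case False
  then show ?thesis using num_edges_vertical_branching[of t] assms by fastforce
next
  case True
  then obtain c u where t: "t = Aux [((c, False), u)]" by blast
  with assms(3) have u: "\<not> is_leaf u" by (cases u) auto
  have "leaves_charged u" using assms(1) t by (auto elim: leaves_charged.cases)
  then have "9 * num_edges (vertical b) + 2 \<le> 8 * wsum flag_weight b"
    if "path_below u = (cs, b)" "\<not> is_leaf b" for cs b
    using path_below_leaves_charged[OF that(1)] path_below_bottom[OF that(1)] that(2)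
    by (intro num_edges_vertical_branching) auto
  from num_edges_vertical_edge[of u "(c, False)", OF this] u show ?thesis
    by (simp add: t vertical_Aux)
qed

section \<open>Iterations\<close>

lemma num_edges_eq_0 [simp]: "num_edges t = 0 \<longleftrightarrow> is_leaf t"
  by (cases t; cases "edges t") auto

lemma num_edges_eq_1: "num_edges t = 1 \<Longrightarrow> single_edge t"
proof (cases t)
  case (Aux es)
  assume *: "num_edges t = 1"
  then obtain e u es' where es: "es = (e, u) # es'" using Aux by (cases es) auto
  have "es' = []" using * Aux es by (cases es') auto
  moreover have "num_edges u = 0" using * Aux es by simp
  then have "is_leaf u" by (simp only: num_edges_eq_0)
  ultimately show ?thesis using Aux es by (cases u) (auto simp: single_edge_def)
qed

lemma num_edges_horizontal_flagged: "wsum flag_weight (horizontal t) = num_edges t"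
  by (rule wsum_horizontal) auto

lemma num_edges_horizontal: "num_edges (horizontal t) \<le> num_edges t"
  unfolding num_edges_horizontal_flagged[symmetric, of t] by (rule wsum_mono) simp

lemma num_edges_iteration:
  assumes "\<not> is_leaf t" "\<not> single_edge t"
  shows "9 * num_edges (iteration t) < 8 * num_edges t"
proof -
  have "horizontal t \<noteq> Aux [((c, False), Aux [])]" for c
  proof
    assume "horizontal t = Aux [((c, False), Aux [])]"
    then have "num_edges t = 1" using num_edges_horizontal_flagged[of t] by simp
    then show False using num_edges_eq_1 assms by blast
  qed
  then have "9 * num_edges (vertical (horizontal t)) + 1 \<le> 8 * wsum flag_weight (horizontal t)"
    using assms(1) by (intro num_edges_vertical leaves_charged_horizontal) auto
  then show ?thesis by (simp only: iteration_def num_edges_horizontal_flagged)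
qed

lemma is_leaf_iteration [simp]: "is_leaf (iteration t) \<longleftrightarrow> is_leaf t"
proof -
  have "is_leaf (vertical u) \<longleftrightarrow> is_leaf u" for u :: "('a cluster \<times> bool) aux_tree"
    by (cases u) (simp add: vertical_Aux)
  then show ?thesis by (simp add: iteration_def)
qed

lemma csize_horizontal: "wsum (csize \<circ> fst) (horizontal t) = wsum csize t"
  by (rule wsum_horizontal) auto

lemma csize_iteration: "wsum csize (iteration t) = wsum csize t"
  unfolding iteration_def by (subst wsum_vertical) (auto simp: csize_horizontal)

lemma wsum_initial:
  assumes "\<And>a. f (CLeaf a) = 1"
  shows "Suc (wsum f (initial T)) = num_nodes T"
proof (induction T)
  case (ONode a ts)
  then have "map (\<lambda>t. Suc (wsum f (initial t))) ts = map num_nodes ts" by simp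
  then show ?case by (simp add: comp_def assms del: map_eq_conv)
qed


text \<open>The clusters that can arise from \<open>X\<close> when every edge takes part in at most one merge.\<close>

definition merges :: "'a cluster set \<Rightarrow> 'a cluster set" where
  "merges X = X \<union> {CMerge m u l | m u l. u \<in> X \<and> l \<in> X}"

lemma hmerge_merges:
  assumes "\<And>p. p \<in> set es \<Longrightarrow> fst p \<in> X" "p \<in> set (hmerge es)"
  shows "fst (fst p) \<in> merges X"
proof -
  have f: "fst (fst (hmerge_edges e h)) \<in> merges X" if "fst e \<in> X" "fst h \<in> X"
    for e h :: "'a cluster \<times> 'e aux_tree"
    using that by (cases e; cases h) (auto simp: merges_def)
  have "(\<forall>p\<in>set es. fst p \<in> X) \<longrightarrow> (\<forall>p\<in>set (hmerge es). fst (fst p) \<in> merges X)"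
    by (induction es rule: hmerge.induct) (auto simp: hpair_def f, auto simp: merges_def)
  then show ?thesis using assms by blast
qed

lemma horizontal_merges: "set_aux_tree t \<subseteq> X \<Longrightarrow> fst ` set_aux_tree (horizontal t) \<subseteq> merges X"
proof (induction t)
  case (Aux es)
  have *: "fst ` set_aux_tree (horizontal (snd p)) \<subseteq> merges X" if "p \<in> set es" for p
    using Aux.IH[OF that, of "snd p"] Aux.prems that
    by (cases p) (force simp: set_aux_tree_Aux simp del: aux_tree.set)
  let ?es = "map (map_prod id horizontal) es"
  have 1: "fst q \<in> X" if "q \<in> set ?es" for q
    using that Aux.prems by (force simp: set_aux_tree_Aux simp del: aux_tree.set)
  have "fst (fst p) \<in> merges X" "fst ` set_aux_tree (snd p) \<subseteq> merges X" if "p \<in> set (hmerge ?es)" for p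
  proof -
    show "fst (fst p) \<in> merges X" by (rule hmerge_merges[OF 1 that])
    from hmerge_children[OF that] obtain q where "q \<in> set es" "snd p = horizontal (snd q)" by auto
    then show "fst ` set_aux_tree (snd p) \<subseteq> merges X" using * by simp
  qed
  then show ?case by (fastforce simp: set_aux_tree_Aux simp del: aux_tree.set)
qed

lemma vpairs_merges: "set cs \<subseteq> X \<Longrightarrow> set (vpairs lf cs) \<subseteq> merges X"
  by (induction lf cs rule: vpairs.induct) (auto simp: merges_def)

lemma vmerge_merges: "fst e \<in> X \<Longrightarrow> set cs \<subseteq> X \<Longrightarrow> set (vmerge lf e cs) \<subseteq> merges X"
  using vpairs_merges[of cs X lf] vpairs_merges[of "tl cs" X lf] vpairs_merges[of "fst e # cs" X lf]
  by (cases e; cases cs) (auto simp: merges_def)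

lemma set_build_path: "set_aux_tree (build_path cs b) = set cs \<union> set_aux_tree b"
  by (induction cs) auto

lemma vertical_merges: "fst ` set_aux_tree t \<subseteq> X \<Longrightarrow> set_aux_tree (vertical t) \<subseteq> merges X"
proof (induction t rule: path_induct)
  case (1 es)
  have "insert (fst (vertical_edge p)) (set_aux_tree (snd (vertical_edge p))) \<subseteq> merges X" if p: "p \<in> set es" for p
  proof -
    obtain e t cs b where q: "p = (e, t)" "path_below t = (cs, b)" by (metis surj_pair)
    obtain d ds where d: "vmerge (is_leaf b) e cs = d # ds"
      using vmerge_not_Nil by (metis list.exhaust)
    have "insert e (set_aux_tree t) \<subseteq> set_aux_tree (Aux es)"
      using UN_upper[OF p, of "\<lambda>p. insert (fst p) (set_aux_tree (snd p))"]
      by (simp only: set_aux_tree_Aux q fst_conv snd_conv)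
    then have et: "fst e \<in> X" "fst ` set_aux_tree t \<subseteq> X"
      using "1.prems" by blast+
    then have "set (vmerge (is_leaf b) e cs) \<subseteq> merges X"
      using path_below_set[OF q(2)] by (intro vmerge_merges) auto
    moreover have "set_aux_tree (vertical b) \<subseteq> merges X"
      using "1.IH"[of e t cs b] p q et path_below_set[OF q(2)] by blast
    ultimately show ?thesis
      by (simp add: vertical_edge_def q d set_build_path)
  qed
  then show ?case by (fastforce simp: vertical_Aux set_aux_tree_Aux simp del: aux_tree.set)
qed

definition subtree_closed :: "'a cluster set \<Rightarrow> bool" where
  "subtree_closed S \<longleftrightarrow> (\<forall>c\<in>S. subtrees c \<subseteq> S)"

lemma subtree_closed_Un_merges:
  assumes "subtree_closed S" "Y \<subseteq> merges S"
  shows "subtree_closed (S \<union> Y)"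
  using assms unfolding subtree_closed_def merges_def by fastforce

primrec clusters_upto :: "'a otree \<Rightarrow> nat \<Rightarrow> 'a cluster set" where
  "clusters_upto T 0 = set_aux_tree (initial T)"
| "clusters_upto T (Suc j) = clusters_upto T j
     \<union> fst ` set_aux_tree (horizontal ((iteration ^^ j) (initial T)))
     \<union> set_aux_tree ((iteration ^^ Suc j) (initial T))"

lemma set_initial: "set_aux_tree (initial T) \<subseteq> CLeaf ` set_otree T"
proof (induction T)
  case (ONode a ts)
  have "label t \<in> set_otree t" for t :: "'a otree" by (cases t) auto
  with ONode show ?case
    by (fastforce simp: set_aux_tree_Aux simp del: aux_tree.set)
qed

lemma clusters_upto_invariant:
  "set_aux_tree ((iteration ^^ j) (initial T)) \<subseteq> clusters_upto T j \<and>
   subtree_closed (clusters_upto T j) \<and> (\<forall>c\<in>clusters_upto T j. set_cluster c \<subseteq> set_otree T)"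
proof (induction j)
  case 0
  then show ?case using set_initial[of T] by (fastforce simp: subtree_closed_def)
next
  case (Suc j)
  let ?t = "(iteration ^^ j) (initial T)"
  let ?S = "clusters_upto T j"
  let ?H = "fst ` set_aux_tree (horizontal ?t)"
  let ?V = "set_aux_tree (iteration ?t)"
  have H: "?H \<subseteq> merges ?S" using Suc horizontal_merges by blast
  have V: "?V \<subseteq> merges (?S \<union> ?H)"
    unfolding iteration_def by (intro vertical_merges) simp
  have "subtree_closed (?S \<union> ?H \<union> ?V)"
    using Suc H V by (intro subtree_closed_Un_merges) auto
  moreover have m: "\<forall>c\<in>merges X. set_cluster c \<subseteq> A" if "\<forall>c\<in>X. set_cluster c \<subseteq> A"
    for X :: "'a cluster set" and A using that by (auto simp: merges_def) blast+
  have "\<forall>c\<in>?S \<union> ?H. set_cluster c \<subseteq> set_otree T" using m[of ?S] Suc H by blast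
  then have "\<forall>c\<in>?S \<union> ?H \<union> ?V. set_cluster c \<subseteq> set_otree T" using m V by blast
  ultimately show ?case by simp
qed

lemma finite_clusters_upto: "finite (clusters_upto T j)"
  by (induction j) auto

lemma iterate_not_leaf:
  assumes "num_nodes T \<ge> 2"
  shows "\<not> is_leaf ((iteration ^^ j) (initial T))"
proof (induction j)
  case 0
  have "num_edges (initial T) \<noteq> 0" using wsum_initial[of "\<lambda>_. 1" T] assms by simp
  then show ?case by (simp del: One_nat_def)
qed simp

lemma top_tree_iterate:
  assumes "num_nodes T \<ge> 2"
  obtains J where "\<And>j. j < J \<Longrightarrow> \<not> single_edge ((iteration ^^ j) (initial T))"
    and "\<And>c. c \<in> subtrees (top_tree T) \<Longrightarrow> c = top_tree T \<or> c = CLeaf (label T) \<or> c \<in> clusters_upto T J"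
proof -
  let ?t = "\<lambda>j. (iteration ^^ j) (initial T)"
  define w where "w = while (\<lambda>t. \<not> single_edge t) iteration (initial T)"
  have "(\<exists>J. w = ?t J \<and> (\<forall>j<J. \<not> single_edge (?t j))) \<and> single_edge w"
    unfolding w_def
  proof (rule while_rule[where r = "measure num_edges" and P = "\<lambda>t. \<exists>J. t = ?t J \<and> (\<forall>j<J. \<not> single_edge (?t j))"])
    fix s assume *: "\<exists>J. s = ?t J \<and> (\<forall>j<J. \<not> single_edge (?t j))" "\<not> single_edge s"
    then obtain J where J: "s = ?t J" "\<forall>j<J. \<not> single_edge (?t j)" by blast
    then show "\<exists>J. iteration s = ?t J \<and> (\<forall>j<J. \<not> single_edge (?t j))"
      using * by (intro exI[of _ "Suc J"]) (auto simp: less_Suc_eq)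
    show "(iteration s, s) \<in> measure num_edges"
      using num_edges_iteration[of s] iterate_not_leaf[OF assms, of J] J * by simp
  qed (auto intro: exI[of _ 0])
  then obtain J where J: "w = ?t J" "\<forall>j<J. \<not> single_edge (?t j)" "single_edge w" by blast
  then obtain c where c: "w = Aux [(c, Aux [])]" by (auto simp: single_edge_def)
  have top: "top_tree T = CMerge MA (CLeaf (label T)) c"
    unfolding top_tree_def w_def[symmetric] by (simp add: c)
  have "c \<in> set_aux_tree (?t J)" using J(1)[symmetric] c by simp
  then have "subtrees c \<subseteq> clusters_upto T J"
    using clusters_upto_invariant[of J T] unfolding subtree_closed_def by blast
  then show ?thesis using J that[of J] by (auto simp: top)
qed

section \<open>Counting small clusters\<close>

fun preorder :: "'a cluster \<Rightarrow> (merge_type + 'a) list" where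
  "preorder (CLeaf a) = [Inr a]"
| "preorder (CMerge m l r) = Inl m # preorder l @ preorder r"

lemma preorder_prefix_free: "preorder c @ xs = preorder d @ ys \<Longrightarrow> c = d \<and> xs = ys"
proof (induction c arbitrary: d xs ys)
  case (CLeaf a)
  then show ?case by (cases d) auto
next
  case (CMerge m l r)
  show ?case
  proof (cases d)
    case (CMerge m' l' r')
    then have "m = m'" "preorder l @ (preorder r @ xs) = preorder l' @ (preorder r' @ ys)"
      using CMerge.prems by auto
    then show ?thesis using CMerge.IH CMerge by metis
  qed (use CMerge.prems in auto)
qed

lemma inj_preorder: "inj preorder"
  using preorder_prefix_free[of _ "[]" _ "[]"] by (auto intro!: injI)

lemma length_preorder: "Suc (length (preorder c)) = 2 * csize c"
  by (induction c) auto

lemma set_preorder: "set (preorder c) \<subseteq> UNIV <+> set_cluster c"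
  by (induction c) auto

lemma UNIV_merge_type: "UNIV = {MA, MB, MC, MD, ME}"
  using merge_type.exhaust by auto

lemma small_clusters:
  assumes "finite \<Sigma>" "card \<Sigma> \<ge> 2"
  shows "finite {c. set_cluster c \<subseteq> \<Sigma> \<and> csize c \<le> s} \<and>
    card {c. set_cluster c \<subseteq> \<Sigma> \<and> csize c \<le> s} \<le> card \<Sigma> ^ (6 * s)"
proof (cases "s = 0")
  case True
  then have e: "{c. set_cluster c \<subseteq> \<Sigma> \<and> csize c \<le> s} = {}"
    using csize_pos by (metis (mono_tags, lifting) Collect_empty_eq le_zero_eq not_one_le_zero)
  show ?thesis unfolding e by simp
next
  case False
  let ?C = "{c. set_cluster c \<subseteq> \<Sigma> \<and> csize c \<le> s}"
  let ?A = "(UNIV :: merge_type set) <+> \<Sigma>"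
  let ?W = "{xs. set xs \<subseteq> ?A \<and> length xs \<le> 2 * s - 1}"
  have fin: "finite (UNIV :: merge_type set)" by (simp add: UNIV_merge_type)
  have A: "finite ?A" "card ?A = 5 + card \<Sigma>"
    using assms fin by (auto simp: card_Plus) (simp add: UNIV_merge_type)
  have sub: "preorder ` ?C \<subseteq> ?W"
  proof
    fix xs assume "xs \<in> preorder ` ?C"
    then obtain c where c: "xs = preorder c" "set_cluster c \<subseteq> \<Sigma>" "csize c \<le> s" by auto
    then show "xs \<in> ?W" using set_preorder[of c] length_preorder[of c] by (auto simp: subset_iff)
  qed
  have finW: "finite ?W" using A finite_lists_length_le by blast
  have geo: "(\<Sum>i\<le>n. a ^ i) \<le> a ^ Suc n" if "a \<ge> 2" for a n :: nat
  proof (induction n)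
    case (Suc n)
    have "(\<Sum>i\<le>Suc n. a ^ i) \<le> 2 * a ^ Suc n" using Suc by simp
    also have "\<dots> \<le> a ^ Suc (Suc n)" using that by simp
    finally show ?case .
  qed (use that in simp)
  have inj: "inj_on preorder ?C" by (rule inj_on_subset[OF inj_preorder]) simp
  then have "card ?C = card (preorder ` ?C)" by (simp only: card_image)
  also have "\<dots> \<le> card ?W" using sub finW by (rule card_mono[rotated])
  also have "\<dots> = (\<Sum>i\<le>2 * s - 1. card ?A ^ i)" by (rule card_lists_length_le) (rule A)
  also have "\<dots> \<le> card ?A ^ Suc (2 * s - 1)" by (rule geo) (simp add: A)
  also have "\<dots> = card ?A ^ (2 * s)" using False by simp
  also have "\<dots> \<le> (card \<Sigma> ^ 3) ^ (2 * s)"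
  proof (rule power_mono)
    have "2 * 2 * card \<Sigma> \<le> card \<Sigma> * card \<Sigma> * card \<Sigma>"
      using assms by (intro mult_mono) auto
    then show "card ?A \<le> card \<Sigma> ^ 3"
      unfolding A(2) power3_eq_cube using assms(2) by linarith
  qed simp
  also have "\<dots> = card \<Sigma> ^ (6 * s)" by (simp flip: power_mult)
  finally show ?thesis
    using finite_imageD[OF finite_subset[OF sub finW] inj] by (simp only: simp_thms)
qed

section \<open>Counting large clusters\<close>

lemma card_large:
  fixes f :: "'e \<Rightarrow> 'a cluster"
  shows "card {c \<in> f ` set_aux_tree t. csize c > s} * (s + 1) \<le> wsum (csize \<circ> f) t"
    and "card {c \<in> f ` set_aux_tree t. csize c > s} \<le> num_edges t"
proof -
  let ?E = "{e \<in> set_aux_tree t. csize (f e) > s}"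
  have eq: "{c \<in> f ` set_aux_tree t. csize c > s} = f ` ?E" by auto
  have c: "card (f ` ?E) \<le> card ?E" by (rule card_image_le) simp
  have "card ?E * (s + 1) \<le> (\<Sum>e\<in>?E. (csize \<circ> f) e)"
    using sum_bounded_below[of ?E "s + 1" "csize \<circ> f"] by simp
  also have "\<dots> \<le> (\<Sum>e\<in>set_aux_tree t. (csize \<circ> f) e)" by (rule sum_mono2) auto
  also have "\<dots> \<le> wsum (csize \<circ> f) t" by (rule sum_set_aux_tree_le_wsum)
  finally show "card {c \<in> f ` set_aux_tree t. csize c > s} * (s + 1) \<le> wsum (csize \<circ> f) t"
    unfolding eq using c by (meson le_trans mult_le_mono1)
  have "card ?E \<le> card (set_aux_tree t)" by (rule card_mono) auto
  also have "\<dots> \<le> num_edges t" using sum_set_aux_tree_le_wsum[of "\<lambda>_. 1" t] by simp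
  finally show "card {c \<in> f ` set_aux_tree t. csize c > s} \<le> num_edges t"
    unfolding eq using c by simp
qed


lemma card_large_real:
  fixes f :: "'e \<Rightarrow> 'a cluster"
  assumes "wsum (csize \<circ> f) t \<le> n" "real (num_edges t) \<le> x * n"
  shows "real (card {c \<in> f ` set_aux_tree t. csize c > s}) \<le> n * min (1 / (real s + 1)) x"
proof -
  let ?k = "card {c \<in> f ` set_aux_tree t. csize c > s}"
  have "?k * (s + 1) \<le> n" using card_large(1)[where f = f and t = t and s = s] assms(1) by linarith
  then have "real (?k * (s + 1)) \<le> real n" by (simp only: of_nat_le_iff)
  then have "real ?k \<le> n * (1 / (real s + 1))" by (simp add: field_simps)
  moreover have "real ?k \<le> n * x"
    using card_large(2)[where f = f and t = t and s = s] assms(2) by (simp add: mult.commute)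
  ultimately show ?thesis by (simp only: min_def split: if_split) blast
qed

lemma geometric_min_sum:
  fixes a q :: real
  assumes "a \<ge> 0" "0 \<le> q" "q < 1"
  shows "(\<Sum>j<J. min a (q ^ j)) \<le> K * a + q ^ K / (1 - q)"
proof -
  have "(\<Sum>j<J. min a (q ^ j)) \<le> (\<Sum>j<K + J. min a (q ^ j))"
    using assms by (intro sum_mono2) auto
  also have "\<dots> = (\<Sum>j<K. min a (q ^ j)) + (\<Sum>j<J. min a (q ^ (K + j)))"
    by (induction J) (auto simp: algebra_simps)
  also have "\<dots> \<le> (\<Sum>j<K. a) + (\<Sum>j<J. q ^ K * q ^ j)"
    by (intro add_mono sum_mono) (auto simp: power_add)
  also have "(\<Sum>j<J. q ^ K * q ^ j) = q ^ K * ((1 - q ^ J) / (1 - q))"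
    using assms by (simp add: sum_distrib_left[symmetric] sum_gp_strict)
  also have "\<dots> \<le> q ^ K * (1 / (1 - q))"
    using assms by (intro mult_left_mono divide_right_mono) auto
  finally show ?thesis by simp
qed

lemma card_large_clusters_upto:
  assumes n: "num_nodes T \<ge> 2"
    and J: "\<And>j. j < J \<Longrightarrow> \<not> single_edge ((iteration ^^ j) (initial T))"
  shows "real (card {c \<in> clusters_upto T J. csize c > s}) \<le>
    real (num_nodes T) * ((2 * real K + 1) / (real s + 1) + 18 * (8 / 9) ^ K)"
proof -
  let ?n = "num_nodes T"
  let ?t = "\<lambda>j. (iteration ^^ j) (initial T)"
  let ?m = "\<lambda>j. min (1 / (real s + 1)) ((8 / 9) ^ j :: real)"
  have size: "wsum csize (?t j) \<le> ?n" for j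
  proof (induction j)
    case 0
    then show ?case using wsum_initial[of csize T] by simp
  qed (simp add: csize_iteration)
  have num: "real (num_edges (?t j)) \<le> (8 / 9) ^ j * ?n" if "j \<le> J" for j
    using that
  proof (induction j)
    case 0
    then show ?case using wsum_initial[of "\<lambda>_. 1" T] by simp
  next
    case (Suc j)
    have "9 * num_edges (?t (Suc j)) < 8 * num_edges (?t j)"
      using num_edges_iteration[OF iterate_not_leaf[OF n, of j]] J[of j] Suc.prems by simp
    then have "9 * real (num_edges (?t (Suc j))) < 8 * real (num_edges (?t j))"
      by linarith
    also have "\<dots> \<le> 8 * ((8 / 9) ^ j * ?n)" using Suc by simp
    finally show ?case by simp
  qed
  have A: "real (card {c \<in> set_aux_tree (?t j). csize c > s}) \<le> ?n * ?m i" if "j \<le> J" "i \<le> j" for i j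
  proof -
    have "real (num_edges (?t j)) \<le> (8 / 9) ^ j * ?n" using num that by blast
    also have "\<dots> \<le> (8 / 9) ^ i * ?n"
      using that by (intro mult_right_mono power_decreasing) auto
    finally have "real (card {c \<in> id ` set_aux_tree (?t j). csize c > s}) \<le> ?n * ?m i"
      using size[of j] by (intro card_large_real) simp_all
    then show ?thesis by (simp only: image_id id_apply)
  qed
  have B: "real (card {c \<in> fst ` set_aux_tree (horizontal (?t j)). csize c > s}) \<le> ?n * ?m j" if "j \<le> J" for j
  proof (rule card_large_real)
    show "wsum (csize \<circ> fst) (horizontal (?t j)) \<le> ?n" using size by (simp only: csize_horizontal)
    show "real (num_edges (horizontal (?t j))) \<le> (8 / 9) ^ j * ?n"
      using num[OF that] num_edges_horizontal[of "?t j"] by linarith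
  qed
  have "real (card {c \<in> clusters_upto T i. csize c > s}) \<le> ?n * (1 / (real s + 1)) + (\<Sum>j<i. 2 * (?n * ?m j))" if "i \<le> J" for i
    using that
  proof (induction i)
    case 0
    have "?n * ?m 0 \<le> ?n * (1 / (real s + 1))" by (intro mult_left_mono) auto
    then show ?case using A[of 0 0] by simp
  next
    case (Suc i)
    have "{c \<in> clusters_upto T (Suc i). csize c > s} = {c \<in> clusters_upto T i. csize c > s}
      \<union> ({c \<in> fst ` set_aux_tree (horizontal (?t i)). csize c > s} \<union> {c \<in> set_aux_tree (?t (Suc i)). csize c > s})"
      (is "_ = ?A \<union> (?B \<union> ?C)") by auto
    moreover have "card (?A \<union> (?B \<union> ?C)) \<le> card ?A + (card ?B + card ?C)"
      using card_Un_le[of ?A "?B \<union> ?C"] card_Un_le[of ?B ?C] by linarith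
    ultimately have "real (card {c \<in> clusters_upto T (Suc i). csize c > s}) \<le> real (card ?A) + (real (card ?B) + real (card ?C))"
      by (simp only: of_nat_add[symmetric] of_nat_le_iff)
    moreover have "real (card ?B) \<le> ?n * ?m i" using B Suc.prems by simp
    moreover have "real (card ?C) \<le> ?n * ?m i" using A[of "Suc i" i] Suc.prems by simp
    moreover have "real (card ?A) \<le> ?n * (1 / (real s + 1)) + (\<Sum>j<i. 2 * (?n * ?m j))" using Suc by simp
    ultimately show ?case by simp
  qed
  from this[of J] have "real (card {c \<in> clusters_upto T J. csize c > s}) \<le>
      ?n * (1 / (real s + 1)) + 2 * ?n * (\<Sum>j<J. ?m j)"
    by (simp add: sum_distrib_left mult.assoc)
  also have "\<dots> \<le> ?n * (1 / (real s + 1)) + 2 * ?n * (K * (1 / (real s + 1)) + (8 / 9) ^ K / (1 - 8 / 9))"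
    by (intro add_left_mono mult_left_mono geometric_min_sum) auto
  also have "\<dots> = ?n * ((2 * real K + 1) / (real s + 1) + 18 * (8 / 9) ^ K)"
    by (simp add: algebra_simps add_divide_distrib)
  finally show ?thesis .
qed

section \<open>The size of the top DAG\<close>

lemma finite_subtrees [simp]: "finite (subtrees c)"
  by (induction c) auto

lemma top_dag_size_le: "top_dag_size T \<le> 3 * card (subtrees (top_tree T))"
proof -
  let ?S = "subtrees (top_tree T)"
  let ?l = "\<lambda>c. (c, False, case c of CMerge m l r \<Rightarrow> l | _ \<Rightarrow> c)"
  let ?r = "\<lambda>c. (c, True, case c of CMerge m l r \<Rightarrow> r | _ \<Rightarrow> c)"
  have "dag_edges (top_tree T) \<subseteq> ?l ` ?S \<union> ?r ` ?S"
    unfolding dag_edges_def by force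
  then have "card (dag_edges (top_tree T)) \<le> card (?l ` ?S \<union> ?r ` ?S)"
    by (intro card_mono) auto
  also have "\<dots> \<le> card ?S + card ?S"
    by (intro order.trans[OF card_Un_le] add_mono card_image_le) auto
  finally show ?thesis by (simp add: top_dag_size_def dag_nodes_def)
qed

lemma card_subtrees_top_tree:
  assumes \<Sigma>: "finite \<Sigma>" "card \<Sigma> \<ge> 2" "set_otree T \<subseteq> \<Sigma>" and n: "num_nodes T \<ge> 2"
  shows "real (card (subtrees (top_tree T))) \<le> 2 + real (card \<Sigma>) ^ (6 * s) +
    real (num_nodes T) * ((2 * real K + 1) / (real s + 1) + 18 * (8 / 9) ^ K)"
proof -
  obtain J where J: "\<And>j. j < J \<Longrightarrow> \<not> single_edge ((iteration ^^ j) (initial T))"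
    and sub: "\<And>c. c \<in> subtrees (top_tree T) \<Longrightarrow> c = top_tree T \<or> c = CLeaf (label T) \<or> c \<in> clusters_upto T J"
    using top_tree_iterate[OF n] by blast
  let ?X = "{top_tree T, CLeaf (label T)}"
  let ?Y = "{c. set_cluster c \<subseteq> \<Sigma> \<and> csize c \<le> s}"
  let ?Z = "{c \<in> clusters_upto T J. csize c > s}"
  have "subtrees (top_tree T) \<subseteq> ?X \<union> (?Y \<union> ?Z)"
    using sub clusters_upto_invariant[of J T] \<Sigma>(3) by fastforce
  then have "card (subtrees (top_tree T)) \<le> card (?X \<union> (?Y \<union> ?Z))"
    using small_clusters[OF \<Sigma>(1,2), of s] finite_clusters_upto[of T J] by (intro card_mono) auto
  also have "\<dots> \<le> card ?X + (card ?Y + card ?Z)"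
    using card_Un_le[of ?X "?Y \<union> ?Z"] card_Un_le[of ?Y ?Z] by linarith
  also have "\<dots> \<le> 2 + (card \<Sigma> ^ (6 * s) + card ?Z)"
    using small_clusters[OF \<Sigma>(1,2), of s] by (intro add_mono) (auto intro: card_insert_le_m1)
  finally have "real (card (subtrees (top_tree T))) \<le> real (2 + (card \<Sigma> ^ (6 * s) + card ?Z))"
    by (simp only: of_nat_le_iff)
  also have "\<dots> = 2 + (real (card \<Sigma>) ^ (6 * s) + real (card ?Z))" by simp
  finally show ?thesis using card_large_clusters_upto[where s = s and K = K, OF n J] by fastforce
qed

lemma log_le_4_sqrt:
  fixes \<sigma> n :: real
  assumes "\<sigma> \<ge> 2" "n \<ge> 1"
  shows "log \<sigma> n \<le> 4 * sqrt n"
proof -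
  have ln2: "ln 2 \<ge> (1 / 2 :: real)"
    using ln_one_minus_pos_upper_bound[of "1 / 2"] by (simp add: ln_div)
  also have "ln 2 \<le> ln \<sigma>" using assms by simp
  finally have ls: "ln \<sigma> \<ge> 1 / 2" .
  have "ln n = 2 * ln (sqrt n)" using assms by (simp add: ln_sqrt)
  also have "\<dots> \<le> 2 * sqrt n" using assms ln_le_minus_one[of "sqrt n"] by simp
  finally have "ln n \<le> 2 * sqrt n" .
  then have "log \<sigma> n \<le> 2 * sqrt n / ln \<sigma>"
    unfolding log_def using ls by (intro divide_right_mono) auto
  also have "\<dots> \<le> 2 * sqrt n / (1 / 2)"
    using ls assms by (intro divide_left_mono) auto
  finally show ?thesis by simp
qed

theorem theorem1:
  fixes b :: real
  assumes "b > 1"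
  shows "\<exists>C>0. \<forall>(\<Sigma> :: 'a set) (T :: 'a otree).
    finite \<Sigma> \<longrightarrow> card \<Sigma> \<ge> 2 \<longrightarrow> set_otree T \<subseteq> \<Sigma> \<longrightarrow>
    log (real (card \<Sigma>)) (real (num_nodes T)) \<ge> b \<longrightarrow>
    real (top_dag_size T) \<le>
      C * (real (num_nodes T) / log (real (card \<Sigma>)) (real (num_nodes T))
             * log 2 (log (real (card \<Sigma>)) (real (num_nodes T))))"
proof -
  define D :: real where "D = 66 / log 2 b + 24 / log 2 (9 / 8)"
  have pos: "log 2 b > 0" "log 2 (9 / 8 :: real) > 0" using assms by simp_all
  then have "D > 0" unfolding D_def by (intro add_pos_pos) auto
  have main: "real (top_dag_size T) \<le> 3 * D * (real (num_nodes T) / log (real (card \<Sigma>)) (real (num_nodes T))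
             * log 2 (log (real (card \<Sigma>)) (real (num_nodes T))))"
    if \<Sigma>: "finite \<Sigma>" "card \<Sigma> \<ge> 2" "set_otree T \<subseteq> \<Sigma>" and bL: "log (real (card \<Sigma>)) (real (num_nodes T)) \<ge> b"
    for \<Sigma> :: "'a set" and T :: "'a otree"
  proof -
    define n where "n = real (num_nodes T)"
    define \<sigma> where "\<sigma> = real (card \<Sigma>)"
    define L where "L = log \<sigma> n"
    define s where "s = nat \<lfloor>L / 12\<rfloor>"
    define K where "K = nat \<lceil>log (9 / 8) L\<rceil>"
    have \<sigma>2: "\<sigma> \<ge> 2" using \<Sigma> by (simp add: \<sigma>_def)
    have Lb: "L \<ge> b" using bL by (simp add: L_def n_def \<sigma>_def)
    then have L1: "L > 1" using assms by simp
    have n1: "n \<ge> 1" by (cases T) (simp add: n_def)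
    have n\<sigma>: "n = \<sigma> powr L" using \<sigma>2 n1 by (simp add: L_def)
    have "\<sigma> powr 1 < \<sigma> powr L" using L1 \<sigma>2 by (intro powr_less_mono) auto
    then have n2: "num_nodes T \<ge> 2" using \<sigma>2 n\<sigma> n_def by simp
    have sL: "s \<le> L / 12" "L / 12 < s + 1"
      using L1 unfolding s_def by (auto simp: of_nat_nat) linarith+
    have "\<sigma> ^ (6 * s) = \<sigma> powr (6 * s)" using \<sigma>2 by (subst powr_realpow[symmetric]) auto
    also have "\<dots> \<le> \<sigma> powr (L / 2)" using sL \<sigma>2 by (intro powr_mono) auto
    also have "\<dots> = sqrt n" using \<sigma>2 by (simp add: n\<sigma> powr_half_sqrt[symmetric] powr_powr)
    finally have small: "\<sigma> ^ (6 * s) \<le> sqrt n" .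
    have "sqrt n * L \<le> sqrt n * (4 * sqrt n)"
      unfolding L_def using \<sigma>2 n1 by (intro mult_left_mono log_le_4_sqrt) auto
    also have "\<dots> = 4 * n" using n1 by simp
    finally have "sqrt n * L \<le> 4 * n" .
    then have sq: "sqrt n \<le> 4 * (n / L)" using n1 L1 by (simp add: field_simps)
    have "log (9 / 8) L > 0" using L1 by simp
    then have K: "log (9 / 8) L \<le> K" "K \<le> log (9 / 8) L + 1"
      unfolding K_def by linarith+
    have "L = (9 / 8) powr (log (9 / 8) L)" using L1 by simp
    also have "\<dots> \<le> (9 / 8) powr K" using K by (intro powr_mono) auto
    also have "\<dots> = (9 / 8) ^ K" by (simp add: powr_realpow)
    finally have "1 / (9 / 8) ^ K \<le> 1 / L" using L1 by (intro divide_left_mono) auto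
    then have qK: "(8 / 9) ^ K \<le> 1 / L" by (simp add: power_divide)
    have "1 / (real s + 1) \<le> 12 / L" using sL L1 by (simp add: field_simps)
    then have "(2 * real K + 1) * (1 / (real s + 1)) \<le> (2 * real K + 1) * (12 / L)" by (intro mult_left_mono) auto
    moreover have "(2 * real K + 1) * (12 / L) + 18 * (1 / L) = (24 * real K + 30) / L"
      using L1 by (simp add: field_simps)
    ultimately have "(2 * real K + 1) / (real s + 1) + 18 * (8 / 9) ^ K \<le> (24 * real K + 30) / L"
      using qK by simp
    then have "n * ((2 * real K + 1) / (real s + 1) + 18 * (8 / 9) ^ K) \<le> n * ((24 * real K + 30) / L)"
      using n1 by (intro mult_left_mono) auto
    then have large: "n * ((2 * real K + 1) / (real s + 1) + 18 * (8 / 9) ^ K) \<le> (24 * real K + 30) * (n / L)"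
      by (simp add: mult.commute)
    have "2 \<le> 2 * sqrt n" using n1 by simp
    with card_subtrees_top_tree[OF \<Sigma> n2, of s K] small large sq
    have "real (card (subtrees (top_tree T))) \<le> 12 * (n / L) + (24 * real K + 30) * (n / L)"
      unfolding n_def \<sigma>_def by linarith
    also have "\<dots> = (24 * real K + 42) * (n / L)" by (simp add: algebra_simps add_divide_distrib)
    also have "\<dots> \<le> (D * log 2 L) * (n / L)"
    proof (rule mult_right_mono)
      have "log 2 b \<le> log 2 L" using Lb assms by simp
      then have "66 \<le> 66 / log 2 b * log 2 L" using pos by (simp add: field_simps)
      moreover have "log (9 / 8) L = log 2 L / log 2 (9 / 8)" by (rule log_base_change) auto
      moreover have "D * log 2 L = 66 / log 2 b * log 2 L + 24 * (log 2 L / log 2 (9 / 8))"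
        by (simp add: D_def distrib_right)
      ultimately show "24 * real K + 42 \<le> D * log 2 L" using K by linarith
    qed (use n1 L1 in simp)
    finally have "real (card (subtrees (top_tree T))) \<le> D * (n / L * log 2 L)" by (simp add: mult_ac)
    moreover have "real (top_dag_size T) \<le> 3 * real (card (subtrees (top_tree T)))"
      using top_dag_size_le[of T] by linarith
    ultimately show ?thesis unfolding L_def n_def \<sigma>_def by linarith
  qed
  show ?thesis
    by (rule exI[of _ "3 * D"]) (use main \<open>D > 0\<close> in auto)
qed

end
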